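(* Each of the following lattices $\mathbf{D}$ lies in the image of $\mathcal{K}^\circ\mathrm{X}$, i.e. there is a commutative BCK-algebra $\mathbf{A}$ such that $\mathbf{D}$ is isomorphic as a lattice to the lattice $\mathcal{K}^\circ\mathrm{X}(\mathbf{A})$ of compact open subsets of the spectrum $\mathrm{X}(\mathbf{A})$: (1) every finite distributive lattice $\mathbf{D}$ whose poset $\mathrm{MI}(\mathbf{D})$ of meet-irreducible elements is isomorphic, as a poset, to $T^\partial$ for some finite rooted tree $T$; (2) every finite chain; (3) every countably infinite chain isomorphic to $(\mathbb{N}_0^\infty)^\partial$; (4) the underlying lattice of every finite subdirectly irreducible distributive p-algebra; (5) the underlying lattice of every finite Boolean algebra.
   Context: A commutative BCK-algebra is an algebra $\mathbf{A}=\langle A;\cdot,0\rangle$ of type $(2,0)$ such that for all $x,y,z\in A$: $(x\cdot y)\cdot z=(x\cdot z)\cdot y$; $x\cdot(x\cdot y)=y\cdot(y\cdot x)$; $x\cdot x=0$; $x\cdot 0=x$. Put $x\wedge y:=y\cdot(y\cdot x)$. An ideal is a subset $I\subseteq A$ with $0\in I$ such that $x\cdot y\in I$ and $y\in I$ imply $x\in I$. An ideal $P$ is prime if $P\neq A$ and $x\wedge y\in P$ implies $x\in P$ or $y\in P$. The spectrum of $\mathbf{A}$ is the set $\mathrm{X}(\mathbf{A})$ of prime ideals of $\mathbf{A}$ with the topology whose open sets are exactly the sets $\sigma(I)=\{P\in\mathrm{X}(\mathbf{A})\mid I\not\subseteq P\}$, $I$ an ideal of $\mathbf{A}$. The compact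 open subsets of $\mathrm{X}(\mathbf{A})$ are closed under finite unions and pairwise intersections; ordered by inclusion they form a distributive lattice with $0$, denoted $\mathcal{K}^\circ\mathrm{X}(\mathbf{A})$ ("compact" does not include Hausdorff). Meet-irreducible elements exclude the top element: $m\in\mathrm{MI}(\mathbf{D})$ iff $m$ is not the top and $m=a\wedge b$ implies $m=a$ or $m=b$. A rooted tree $T$ with root $\lambda$ is regarded as a poset with $\alpha\le\beta$ iff $\alpha$ is $\beta$ or an ancestor of $\beta$ (so the root is the least element), and $T^\partial$ denotes its order-dual. $\mathbb{N}_0^\infty=\{0,1,2,\dots\}\cup\{\infty\}$ with $k<\infty$ for all $k$, and $(\mathbb{N}_0^\infty)^\partial$ is its order-dual. A p-algebra is a pseudocomplemented lattice, i.e. a bounded lattice with a unary operation ${}^\ast$ (part of the signature) such that $x\wedge y=0\iff y\le x^\ast$; it is distributive if its lattice is. *)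

theory Defs
  imports "HOL-Analysis.Abstract_Topology" "HOL-Library.Extended_Nat"
begin

locale commutative_bck_algebra =
  fixes A :: "'a set"
    and mult :: "'a \<Rightarrow> 'a \<Rightarrow> 'a"  (infixl "\<cdot>" 70)
    and zero :: 'a  ("\<zero>")
  assumes mult_closed: "\<lbrakk>x \<in> A; y \<in> A\<rbrakk> \<Longrightarrow> x \<cdot> y \<in> A"
    and zero_closed: "\<zero> \<in> A"
    and exchange: "\<lbrakk>x \<in> A; y \<in> A; z \<in> A\<rbrakk> \<Longrightarrow> (x \<cdot> y) \<cdot> z = (x \<cdot> z) \<cdot> y"
    and commutative: "\<lbrakk>x \<in> A; y \<in> A\<rbrakk> \<Longrightarrow> x \<cdot> (x \<cdot> y) = y \<cdot> (y \<cdot> x)"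
    and mult_self: "x \<in> A \<Longrightarrow> x \<cdot> x = \<zero>"
    and mult_zero: "x \<in> A \<Longrightarrow> x \<cdot> \<zero> = x"
begin

definition meet :: "'a \<Rightarrow> 'a \<Rightarrow> 'a" where
  "meet x y = y \<cdot> (y \<cdot> x)"

definition ideal :: "'a set \<Rightarrow> bool" where
  "ideal I \<longleftrightarrow> I \<subseteq> A \<and> \<zero> \<in> I \<and> (\<forall>x\<in>A. \<forall>y\<in>A. x \<cdot> y \<in> I \<and> y \<in> I \<longrightarrow> x \<in> I)"

definition prime_ideal :: "'a set \<Rightarrow> bool" where
  "prime_ideal P \<longleftrightarrow> ideal P \<and> P \<noteq> A \<and>
     (\<forall>x\<in>A. \<forall>y\<in>A. meet x y \<in> P \<longrightarrow> x \<in> P \<or> y \<in> P)"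

definition sigma :: "'a set \<Rightarrow> 'a set set" where
  "sigma I = {P. prime_ideal P \<and> \<not> I \<subseteq> P}"

definition spectrum :: "'a set topology" where
  "spectrum = topology (\<lambda>U. \<exists>I. ideal I \<and> U = sigma I)"

definition compact_opens :: "'a set set set" where
  "compact_opens = {U. openin spectrum U \<and> compactin spectrum U}"

lemma zero_mult: "z \<in> A \<Longrightarrow> \<zero> \<cdot> z = \<zero>"
proof -
  assume z: "z \<in> A"
  have "\<zero> \<cdot> (\<zero> \<cdot> z) = \<zero>"
    using commutative[OF zero_closed z] mult_zero[OF z] mult_self[OF z] by simp
  then show "\<zero> \<cdot> z = \<zero>"
    using exchange[OF zero_closed mult_closed[OF zero_closed z] z]
      mult_self[OF mult_closed[OF zero_closed z]] by simp
qed

lemma meet_in_ideal: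
  assumes "ideal I" "x \<in> A" "y \<in> A" "x \<in> I \<or> y \<in> I"
  shows "meet x y \<in> I"
proof -
  have *: "v \<cdot> (v \<cdot> u) \<in> I" if "u \<in> A" "v \<in> I" for u v
  proof -
    have v: "v \<in> A" using assms(1) that(2) by (auto simp: ideal_def)
    have "(v \<cdot> (v \<cdot> u)) \<cdot> v = \<zero>"
      using exchange[OF v mult_closed[OF v that(1)] v] mult_self[OF v]
        zero_mult[OF mult_closed[OF v that(1)]] by simp
    moreover have "v \<cdot> (v \<cdot> u) \<in> A" using v that(1) by (simp add: mult_closed)
    ultimately show ?thesis
      using assms(1) that(2) v unfolding ideal_def by auto
  qed
  show ?thesis
    using assms(4) *[of x y] *[of y x] commutative[of x y] assms(2,3) unfolding meet_def by auto
qed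

lemma ideal_subset: "ideal I \<Longrightarrow> I \<subseteq> A"
  by (simp add: ideal_def)

lemma ideal_carrier: "ideal A"
  by (simp add: ideal_def zero_closed)

lemma ideal_Inter:
  assumes "F \<noteq> {}" "\<And>I. I \<in> F \<Longrightarrow> ideal I"
  shows "ideal (\<Inter>F)"
  unfolding ideal_def
proof (intro conjI ballI impI)
  show "\<Inter>F \<subseteq> A" using assms ideal_subset by (meson Inf_less_eq)
  show "\<zero> \<in> \<Inter>F" using assms(2) by (simp add: ideal_def)
  fix x y assume xy: "x \<in> A" "y \<in> A" and *: "x \<cdot> y \<in> \<Inter>F \<and> y \<in> \<Inter>F"
  show "x \<in> \<Inter>F"
  proof
    fix I assume "I \<in> F"
    then have "ideal I" "x \<cdot> y \<in> I" "y \<in> I" using assms(2) * by auto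
    then show "x \<in> I" using xy unfolding ideal_def by blast
  qed
qed

lemma istopology_spectrum: "istopology (\<lambda>U. \<exists>I. ideal I \<and> U = sigma I)"
  unfolding istopology_def
proof (intro conjI allI impI)
  fix S T
  assume "\<exists>I. ideal I \<and> S = sigma I" "\<exists>I. ideal I \<and> T = sigma I"
  then obtain I J where I: "ideal I" "S = sigma I" and J: "ideal J" "T = sigma J"
    by blast
  have "ideal (\<Inter>{I, J})"
    using I(1) J(1) by (intro ideal_Inter) auto
  then have "ideal (I \<inter> J)" by simp
  moreover have "sigma I \<inter> sigma J = sigma (I \<inter> J)"
  proof
    show "sigma I \<inter> sigma J \<subseteq> sigma (I \<inter> J)"
    proof
      fix P assume P: "P \<in> sigma I \<inter> sigma J"
      then obtain x y where xy: "x \<in> I" "x \<notin> P" "y \<in> J" "y \<notin> P" and pr: "prime_ideal P"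
        by (auto simp: sigma_def)
      have A: "x \<in> A" "y \<in> A" using xy I J by (auto simp: ideal_def)
      have "meet x y \<in> I \<inter> J" using meet_in_ideal A xy I J by simp
      moreover have "meet x y \<notin> P" using pr xy A by (auto simp: prime_ideal_def)
      ultimately show "P \<in> sigma (I \<inter> J)" using pr by (auto simp: sigma_def)
    qed
  qed (auto simp: sigma_def)
  ultimately show "\<exists>K. ideal K \<and> S \<inter> T = sigma K" using I J by blast
next
  fix \<K> :: "'a set set set"
  assume K: "\<forall>U\<in>\<K>. \<exists>I. ideal I \<and> U = sigma I"
  define G where "G = \<Union>{I. ideal I \<and> sigma I \<in> \<K>}"
  define J where "J = \<Inter>{I. ideal I \<and> G \<subseteq> I}"
  have "G \<subseteq> A" unfolding G_def by (auto dest: ideal_subset)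
  then have J: "ideal J" unfolding J_def by (intro ideal_Inter) (auto intro: ideal_carrier)
  have "G \<subseteq> J" unfolding J_def by auto
  have G: "I \<subseteq> G" if "ideal I" "sigma I \<in> \<K>" for I
    using that unfolding G_def by auto
  have "P \<in> sigma J" if "U \<in> \<K>" "P \<in> U" for P U
  proof -
    from bspec[OF K that(1)] obtain I where I: "ideal I" "U = sigma I"
      by (elim exE conjE)
    then have "I \<subseteq> J" using G[of I] \<open>G \<subseteq> J\<close> that(1) by simp
    then show ?thesis using that(2) I(2) by (auto simp: sigma_def)
  qed
  moreover have "P \<in> \<Union>\<K>" if "P \<in> sigma J" for P
  proof -
    have P: "prime_ideal P" "\<not> J \<subseteq> P" using that by (simp_all add: sigma_def)
    then have "ideal P" by (simp add: prime_ideal_def)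
    have "\<not> G \<subseteq> P"
    proof
      assume "G \<subseteq> P"
      then have "J \<subseteq> P" unfolding J_def using \<open>ideal P\<close> by (intro Inter_lower) simp
      then show False using P(2) by simp
    qed
    then obtain I where I: "ideal I" "sigma I \<in> \<K>" "\<not> I \<subseteq> P"
      unfolding G_def Sup_le_iff by blast
    then have "P \<in> sigma I" using P(1) by (simp add: sigma_def)
    then show ?thesis using I(2) by (rule UnionI[rotated])
  qed
  ultimately have "\<Union>\<K> = sigma J" by (intro equalityI subsetI) auto
  then show "\<exists>I. ideal I \<and> \<Union>\<K> = sigma I" using J by (intro exI[of _ J]) simp
qed

lemma openin_spectrum: "openin spectrum U \<longleftrightarrow> (\<exists>I. ideal I \<and> U = sigma I)"
  unfolding spectrum_def using topology_inverse'[OF istopology_spectrum] by simp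

lemma topspace_spectrum: "topspace spectrum = {P. prime_ideal P}"
proof -
  have "sigma A = {P. prime_ideal P}"
    by (auto simp: sigma_def prime_ideal_def dest: ideal_subset)
  then have "openin spectrum {P. prime_ideal P}"
    unfolding openin_spectrum using ideal_carrier by (intro exI[of _ A]) simp
  moreover have "topspace spectrum \<subseteq> {P. prime_ideal P}"
    using openin_topspace[of spectrum] unfolding openin_spectrum by (auto simp: sigma_def)
  ultimately show ?thesis by (simp add: openin_subset subset_antisym)
qed

end

text \<open>
  The lattice is given by its type. HOL cannot quantify existentially over types, so the
  algebra is sought among those carried by a subset of the fixed type \<^typ>\<open>nat \<Rightarrow> int\<close>;
  this implies the existence of some commutative BCK-algebra. The compact opens form a lattice
  under intersection and union.
\<close>

definition in_image_KX :: "'d::lattice itself \<Rightarrow> bool" where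
  "in_image_KX _ \<longleftrightarrow>
     (\<exists>(A :: (nat \<Rightarrow> int) set) mult zero (\<phi> :: 'd \<Rightarrow> (nat \<Rightarrow> int) set set).
        commutative_bck_algebra A mult zero \<and>
        bij_betw \<phi> UNIV (commutative_bck_algebra.compact_opens A mult zero) \<and>
        (\<forall>x y. \<phi> (inf x y) = \<phi> x \<inter> \<phi> y) \<and>
        (\<forall>x y. \<phi> (sup x y) = \<phi> x \<union> \<phi> y))"

definition poset_iso ::
  "'a set \<Rightarrow> ('a \<Rightarrow> 'a \<Rightarrow> bool) \<Rightarrow> 'b set \<Rightarrow> ('b \<Rightarrow> 'b \<Rightarrow> bool) \<Rightarrow> bool" where
  "poset_iso P leP Q leQ \<longleftrightarrow>
     (\<exists>f. bij_betw f P Q \<and> (\<forall>x\<in>P. \<forall>y\<in>P. leP x y \<longleftrightarrow> leQ (f x) (f y)))"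

definition MI :: "'a::lattice set" where
  "MI = {m. \<not> (\<forall>x. x \<le> m) \<and> (\<forall>a b. m = inf a b \<longrightarrow> m = a \<or> m = b)}"

text \<open>Edges \<^term>\<open>(u, v) \<in> E\<close> point from a parent \<open>u\<close> to its child \<open>v\<close>.\<close>

definition rooted_tree :: "'v set \<Rightarrow> ('v \<times> 'v) set \<Rightarrow> 'v \<Rightarrow> bool" where
  "rooted_tree V E r \<longleftrightarrow>
     r \<in> V \<and> E \<subseteq> V \<times> V \<and>
     (\<forall>u. (u, r) \<notin> E) \<and>
     (\<forall>v\<in>V - {r}. \<exists>!u. (u, v) \<in> E) \<and>
     (\<forall>v\<in>V. (r, v) \<in> E\<^sup>*)"

definition tree_le :: "('v \<times> 'v) set \<Rightarrow> 'v \<Rightarrow> 'v \<Rightarrow> bool" where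
  "tree_le E \<alpha> \<beta> \<longleftrightarrow> (\<alpha>, \<beta>) \<in> E\<^sup>*"

definition pseudocomplementation :: "('a::bounded_lattice \<Rightarrow> 'a) \<Rightarrow> bool" where
  "pseudocomplementation star \<longleftrightarrow> (\<forall>x y. inf x y = bot \<longleftrightarrow> y \<le> star x)"

definition p_congruence :: "('a::bounded_lattice \<Rightarrow> 'a) \<Rightarrow> ('a \<times> 'a) set \<Rightarrow> bool" where
  "p_congruence star \<theta> \<longleftrightarrow>
     equiv UNIV \<theta> \<and>
     (\<forall>x x'. (x, x') \<in> \<theta> \<longrightarrow> (star x, star x') \<in> \<theta>) \<and>
     (\<forall>x x' y y'. (x, x') \<in> \<theta> \<and> (y, y') \<in> \<theta> \<longrightarrow>
        (inf x y, inf x' y') \<in> \<theta> \<and> (sup x y, sup x' y') \<in> \<theta>)"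

text \<open>
  The kernels of the projections of a subdirect embedding into a nonempty product form a
  nonempty set of congruences intersecting in the identity, and every such set arises from the
  embedding into the product of the quotients; a projection restricts to an isomorphism iff its
  kernel is the identity. One-element algebras count as subdirectly irreducible.
\<close>

definition p_subdirectly_irreducible :: "('a::bounded_lattice \<Rightarrow> 'a) \<Rightarrow> bool" where
  "p_subdirectly_irreducible star \<longleftrightarrow>
     (\<forall>C. C \<noteq> {} \<and> (\<forall>\<theta>\<in>C. p_congruence star \<theta>) \<and> \<Inter>C = Id \<longrightarrow> Id \<in> C)"

end

theory Submission
  imports Defs "HOL-Library.Function_Algebras"
begin

text \<open>
  All five classes are instances of one construction. Call a poset \<open>\<Delta>\<close> a root system if the
  elements above any given point form a chain, and suppose that every nonempty subset of such a
  chain has a greatest element. Bounded functions \<open>\<Delta> \<Rightarrow> int\<close> then form a lattice-ordered abelian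
  group in the style of Hahn: \<open>f\<close> is nonnegative if its value at every maximal point of its
  support is positive, so that on the chain above each point functions are compared
  lexicographically. In the positive cone of such a group, truncated subtraction
  \<open>x \<cdot> y = (x - y) \<squnion> 0\<close> is a commutative BCK-algebra; the axioms are checked on one chain at a
  time, where the order is total.

  Some multiple of \<open>f\<close> dominates every \<open>g\<close> whose support lies below that of \<open>f\<close>
  (\<open>ideal_absorbs\<close>), so membership in an ideal depends only on the down-set generated by the
  support. If the down-sets of \<open>\<Delta>\<close> satisfy the ascending chain condition, ideals correspond to
  down-sets (\<open>ideal_is_supp_ideal\<close>). Distinct down-sets are separated by the prime ideals of
  functions vanishing above a fixed point, and every open set is compact. The lattice of compact
  open sets is therefore the lattice of down-sets of \<open>\<Delta>\<close> (\<open>in_image_KX_if_down_sets\<close>).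

  By Birkhoff duality a finite distributive lattice is the lattice of down-sets of its poset of
  meet-irreducibles, so it suffices that this poset is a root system
  (\<open>in_image_KX_if_MI_root_system\<close>). This is so when it is the dual of a rooted tree, because the
  ancestors of a vertex form a chain; when the lattice is a chain; and when the lattice is
  Boolean, because then it is an antichain. The dual of \<open>enat\<close> is the lattice of down-sets of
  \<open>\<nat>\<close> with the reversed order. For a subdirectly irreducible distributive p-algebra, two families
  of explicit congruences force the meet-irreducibles above any given one to form a chain
  (\<open>subdirectly_irreducible_MI_chain\<close>).
\<close>

section \<open>Root systems and the positive part of a function\<close>

text \<open>
  The last axiom is the ascending chain condition for down-sets in the form in which it is
  applied: to find leading points of supports, to describe an ideal by a single down-set, and to
  extract finite subcovers.
\<close>
locale noetherian_root_system =
  fixes \<Delta> :: "'i set"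
    and le :: "'i \<Rightarrow> 'i \<Rightarrow> bool"  (infix "\<sqsubseteq>" 50)
  assumes refl: "d \<in> \<Delta> \<Longrightarrow> d \<sqsubseteq> d"
    and trans: "\<lbrakk>c \<in> \<Delta>; d \<in> \<Delta>; e \<in> \<Delta>; c \<sqsubseteq> d; d \<sqsubseteq> e\<rbrakk> \<Longrightarrow> c \<sqsubseteq> e"
    and antisym: "\<lbrakk>c \<in> \<Delta>; d \<in> \<Delta>; c \<sqsubseteq> d; d \<sqsubseteq> c\<rbrakk> \<Longrightarrow> c = d"
    and chain_above: "\<lbrakk>c \<in> \<Delta>; d \<in> \<Delta>; e \<in> \<Delta>; c \<sqsubseteq> d; c \<sqsubseteq> e\<rbrakk> \<Longrightarrow> d \<sqsubseteq> e \<or> e \<sqsubseteq> d"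
    and noetherian:
      "(\<And>W. W \<in> F \<Longrightarrow> W \<subseteq> \<Delta> \<and> (\<forall>d\<in>W. \<forall>c\<in>\<Delta>. c \<sqsubseteq> d \<longrightarrow> c \<in> W)) \<Longrightarrow>
         \<exists>G\<subseteq>F. finite G \<and> \<Union>G = \<Union>F"
begin

definition down_set :: "'i set \<Rightarrow> bool" where
  "down_set W \<longleftrightarrow> W \<subseteq> \<Delta> \<and> (\<forall>d\<in>W. \<forall>c\<in>\<Delta>. c \<sqsubseteq> d \<longrightarrow> c \<in> W)"

definition up :: "'i \<Rightarrow> 'i set" where
  "up d = {e \<in> \<Delta>. d \<sqsubseteq> e}"

lemma up_self: "d \<in> \<Delta> \<Longrightarrow> d \<in> up d"
  by (simp add: up_def refl)

lemma up_mono: "d \<in> \<Delta> \<Longrightarrow> e \<in> up d \<Longrightarrow> up e \<subseteq> up d"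
  by (auto simp: up_def intro: trans)

lemma finite_chain_has_greatest:
  assumes "finite T" "T \<noteq> {}" "T \<subseteq> up d" "d \<in> \<Delta>"
  shows "\<exists>t\<in>T. \<forall>s\<in>T. s \<sqsubseteq> t"
  using assms
proof (induction T rule: finite_ne_induct)
  case (singleton x)
  then show ?case by (auto simp: up_def refl)
next
  case (insert x T)
  then obtain t where t: "t \<in> T" "\<forall>s\<in>T. s \<sqsubseteq> t" by auto
  have in_D: "x \<in> \<Delta>" "t \<in> \<Delta>" "T \<subseteq> \<Delta>" "d \<sqsubseteq> x" "d \<sqsubseteq> t"
    using insert.prems t by (auto simp: up_def)
  then consider "x \<sqsubseteq> t" | "t \<sqsubseteq> x" using chain_above insert.prems by blast
  then show ?case
  proof cases
    case 1 with t show ?thesis by auto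
  next
    case 2
    then have "\<forall>s\<in>T. s \<sqsubseteq> x" using t in_D trans by blast
    with in_D refl show ?thesis by auto
  qed
qed

text \<open>
  The sets below a point of \<open>S\<close> have a finite subfamily with the same union; as
  \<open>S\<close> is a chain, one of these finitely many points dominates the others.
\<close>
lemma chain_has_greatest:
  assumes "S \<noteq> {}" "S \<subseteq> up d" "d \<in> \<Delta>"
  shows "\<exists>t\<in>S. \<forall>s\<in>S. s \<sqsubseteq> t"
proof -
  define below where "below s = {c \<in> \<Delta>. c \<sqsubseteq> s}" for s
  have S: "S \<subseteq> \<Delta>" using assms by (auto simp: up_def)
  have "\<exists>G \<subseteq> below ` S. finite G \<and> \<Union>G = \<Union>(below ` S)"
    using S by (intro noetherian) (auto simp: below_def intro: trans)
  then obtain T where T: "T \<subseteq> S" "finite T" "\<Union>(below ` T) = \<Union>(below ` S)"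
    by (metis finite_subset_image)
  have S_below: "s \<in> \<Union>(below ` T)" if "s \<in> S" for s
  proof -
    have "s \<in> below s" using that S refl by (auto simp: below_def)
    then show ?thesis unfolding T(3) using that by blast
  qed
  then have "T \<noteq> {}" using assms(1) by auto
  then obtain t where t: "t \<in> T" "\<forall>s\<in>T. s \<sqsubseteq> t"
    using finite_chain_has_greatest[of T d] T(1,2) assms(2,3) by (meson order_trans)
  have "s \<sqsubseteq> t" if "s \<in> S" for s
    using S_below[OF that] t T(1) S by (auto simp: below_def intro: trans)
  with t T show ?thesis by blast
qed

text \<open>
  On the chain above \<open>d\<close> functions are compared lexicographically, the greatest index being the
  most significant; \<open>pos_at f d\<close> says that \<open>f\<close> is positive there.
\<close>
definition pos_at :: "('i \<Rightarrow> int) \<Rightarrow> 'i \<Rightarrow> bool" where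
  "pos_at f d \<longleftrightarrow> (\<exists>e\<in>up d. f e > 0 \<and> (\<forall>h\<in>up e. h \<noteq> e \<longrightarrow> f h = 0))"

lemma pos_atI:
  "\<lbrakk>e \<in> up d; f e > 0; \<And>h. h \<in> up e \<Longrightarrow> h \<noteq> e \<Longrightarrow> f h = 0\<rbrakk> \<Longrightarrow> pos_at f d"
  unfolding pos_at_def by blast

lemma pos_at_cong:
  assumes "d \<in> \<Delta>" "\<And>h. h \<in> up d \<Longrightarrow> f h = g h"
  shows "pos_at f d = pos_at g d"
proof -
  have "f h = g h" if "e \<in> up d" "h \<in> up e" for e h
    using assms up_mono that by blast
  then show ?thesis unfolding pos_at_def using assms(2) by (metis (no_types))
qed

lemma pos_at_trichotomy:
  assumes "d \<in> \<Delta>"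
  shows "pos_at f d \<or> pos_at (- f) d \<or> (\<forall>h\<in>up d. f h = 0)"
proof (cases "\<exists>h\<in>up d. f h \<noteq> 0")
  case True
  then obtain t where t: "t \<in> up d" "f t \<noteq> 0" "\<forall>s\<in>{h\<in>up d. f h \<noteq> 0}. s \<sqsubseteq> t"
    using chain_has_greatest[of "{h\<in>up d. f h \<noteq> 0}" d] assms by auto
  have zero: "f h = 0" if "h \<in> up t" "h \<noteq> t" for h
  proof (rule ccontr)
    assume "f h \<noteq> 0"
    moreover have "h \<in> up d" using up_mono[OF assms t(1)] that by auto
    ultimately have "h \<sqsubseteq> t" using t(3) by auto
    then show False using antisym that t(1) by (auto simp: up_def)
  qed
  then show ?thesis
    using t(1,2) pos_atI[of t d f] pos_atI[of t d "- f"] by (cases "f t > 0") auto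
qed auto

lemma pos_at_exclusive:
  assumes "d \<in> \<Delta>" "pos_at f d"
  shows "\<not> pos_at (- f) d"
proof
  assume "pos_at (- f) d"
  then obtain e' where e': "e' \<in> up d" "f e' < 0" "\<forall>h\<in>up e'. h \<noteq> e' \<longrightarrow> f h = 0"
    by (auto simp: pos_at_def)
  obtain e where e: "e \<in> up d" "f e > 0" "\<forall>h\<in>up e. h \<noteq> e \<longrightarrow> f h = 0"
    using assms(2) by (auto simp: pos_at_def)
  have "e \<in> up e' \<or> e' \<in> up e"
    using e(1) e'(1) chain_above assms(1) by (auto simp: up_def)
  then show False using e e' by (metis less_irrefl order_less_trans)
qed

lemma pos_at_add:
  assumes d: "d \<in> \<Delta>" and "pos_at f d" "pos_at g d"
  shows "pos_at (f + g) d"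
proof -
  obtain e where e: "e \<in> up d" "f e > 0" "\<forall>h\<in>up e. h \<noteq> e \<longrightarrow> f h = 0"
    using assms(2) by (auto simp: pos_at_def)
  obtain e' where e': "e' \<in> up d" "g e' > 0" "\<forall>h\<in>up e'. h \<noteq> e' \<longrightarrow> g h = 0"
    using assms(3) by (auto simp: pos_at_def)
  have D: "e \<in> \<Delta>" "e' \<in> \<Delta>" using e e' by (auto simp: up_def)
  consider "e = e'" | "e \<noteq> e'" "e \<in> up e'" | "e \<noteq> e'" "e' \<in> up e"
    using e(1) e'(1) chain_above d by (auto simp: up_def)
  then show ?thesis
  proof cases
    case 1
    then show ?thesis using e e' by (intro pos_atI[of e]) auto
  next
    case 2
    then have "h \<in> up e \<Longrightarrow> h \<in> up e' \<and> h \<noteq> e'" for h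
      using up_mono[OF D(2)] antisym[OF D] by (auto simp: up_def)
    then show ?thesis using e e' 2 by (intro pos_atI[of e]) auto
  next
    case 3
    then have "h \<in> up e' \<Longrightarrow> h \<in> up e \<and> h \<noteq> e" for h
      using up_mono[OF D(1)] antisym[OF D] by (auto simp: up_def)
    then show ?thesis using e e' 3 by (intro pos_atI[of e']) auto
  qed
qed

lemma not_pos_at_zero: "(\<And>h. h \<in> up d \<Longrightarrow> f h = 0) \<Longrightarrow> \<not> pos_at f d"
  by (auto simp: pos_at_def)

definition pos_part :: "('i \<Rightarrow> int) \<Rightarrow> 'i \<Rightarrow> int" where
  "pos_part f d = (if d \<in> \<Delta> \<and> pos_at f d then f d else 0)"

lemma pos_part_outside: "d \<notin> \<Delta> \<Longrightarrow> pos_part f d = 0"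
  by (simp add: pos_part_def)

lemma pos_part_cong:
  assumes "d \<in> \<Delta>" "\<And>h. h \<in> up d \<Longrightarrow> f h = g h"
  shows "pos_part f d = pos_part g d"
  using pos_at_cong[of d f g] assms up_self by (simp add: pos_part_def)

text \<open>
  Passing to the positive part is a choice made once for the whole chain above \<open>d\<close>: either
  nothing changes there or everything vanishes there. This reduces identities between positive
  parts to computations in a totally ordered group.
\<close>
lemma pos_part_of_pos_at:
  assumes "d \<in> \<Delta>" "pos_at f d" "h \<in> up d"
  shows "pos_part f h = f h"
proof -
  obtain e where e: "e \<in> up d" "f e > 0" "\<forall>k\<in>up e. k \<noteq> e \<longrightarrow> f k = 0"
    using assms(2) by (auto simp: pos_at_def)
  have "h \<in> up e \<or> e \<in> up h"
    using e(1) assms(1,3) chain_above by (auto simp: up_def)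
  moreover have ?thesis if "e \<in> up h"
    using that e pos_atI[of e h f] assms(3) by (auto simp: pos_part_def up_def)
  moreover have ?thesis if "h \<in> up e" "h \<noteq> e"
    using that e by (simp add: pos_part_def)
  moreover have "e \<in> up e" using e(1) up_self by (simp add: up_def)
  ultimately show ?thesis by blast
qed

lemma pos_part_of_not_pos_at:
  assumes "d \<in> \<Delta>" "\<not> pos_at f d" "h \<in> up d"
  shows "pos_part f h = 0"
proof -
  have "\<not> pos_at f h" using assms up_mono unfolding pos_at_def by blast
  then show ?thesis by (simp add: pos_part_def)
qed

section \<open>The algebra of a root system\<close>

text \<open>
  Boundedness serves in \<open>ideal_absorbs\<close>: one multiple of \<open>f\<close> dominates \<open>g\<close> at all maximal points
  of the support of \<open>f\<close> simultaneously.
\<close>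
definition cone :: "('i \<Rightarrow> int) set" where
  "cone = {f. (\<forall>d. d \<notin> \<Delta> \<longrightarrow> f d = 0) \<and> (\<exists>N. \<forall>d. \<bar>f d\<bar> \<le> N) \<and> (\<forall>d\<in>\<Delta>. \<not> pos_at (- f) d)}"

definition tdiff :: "('i \<Rightarrow> int) \<Rightarrow> ('i \<Rightarrow> int) \<Rightarrow> 'i \<Rightarrow> int" where
  "tdiff x y = pos_part (x - y)"

lemma cone_outside: "f \<in> cone \<Longrightarrow> d \<notin> \<Delta> \<Longrightarrow> f d = 0"
  by (simp add: cone_def)

lemma cone_not_neg: "f \<in> cone \<Longrightarrow> d \<in> \<Delta> \<Longrightarrow> \<not> pos_at (- f) d"
  by (simp add: cone_def)

lemma cone_cases:
  assumes "f \<in> cone" "d \<in> \<Delta>"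
  obtains "pos_at f d" | "\<And>h. h \<in> up d \<Longrightarrow> f h = 0"
  using pos_at_trichotomy[OF assms(2), of f] cone_not_neg[OF assms] by blast

lemma pos_part_cone: "f \<in> cone \<Longrightarrow> pos_part f = f"
proof
  fix d assume f: "f \<in> cone"
  show "pos_part f d = f d"
  proof (cases "d \<in> \<Delta>")
    case True
    from f True show ?thesis
    proof (cases rule: cone_cases)
      case 1
      then show ?thesis using True by (simp add: pos_part_def)
    next
      case 2
      then show ?thesis using up_self[OF True] by (simp add: pos_part_def)
    qed
  qed (simp add: pos_part_outside cone_outside[OF f])
qed

lemma zero_in_cone: "0 \<in> cone"
  using not_pos_at_zero[of _ "- 0"] by (auto simp: cone_def)

lemma pos_part_in_cone:
  assumes "\<And>d. \<bar>f d\<bar> \<le> N"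
  shows "pos_part f \<in> cone"
proof -
  have "\<bar>pos_part f d\<bar> \<le> N" for d
    using assms[of d] by (auto simp: pos_part_def)
  moreover have "\<not> pos_at (- pos_part f) d" if d: "d \<in> \<Delta>" for d
  proof (cases "pos_at f d")
    case True
    then have "pos_at (- pos_part f) d = pos_at (- f) d"
      using d by (intro pos_at_cong) (auto simp: pos_part_of_pos_at)
    then show ?thesis using pos_at_exclusive[OF d True] by simp
  next
    case False
    then show ?thesis
      using d by (intro not_pos_at_zero) (auto simp: pos_part_of_not_pos_at)
  qed
  ultimately show ?thesis unfolding cone_def by (auto simp: pos_part_outside)
qed

lemma tdiff_in_cone:
  assumes "x \<in> cone" "y \<in> cone"
  shows "tdiff x y \<in> cone"
proof -
  obtain N where N: "\<And>d. \<bar>x d\<bar> \<le> N" using assms(1) by (auto simp: cone_def)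
  obtain M where M: "\<And>d. \<bar>y d\<bar> \<le> M" using assms(2) by (auto simp: cone_def)
  have "\<bar>(x - y) d\<bar> \<le> N + M" for d using N[of d] M[of d] by simp
  then show ?thesis unfolding tdiff_def by (rule pos_part_in_cone)
qed

text \<open>
  Where \<open>u\<close> is not positive both sides vanish because \<open>z\<close> is nonnegative. It follows that
  \<open>(x \<cdot> y) \<cdot> z\<close> is the positive part of \<open>x - y - z\<close>, which is symmetric in \<open>y\<close> and \<open>z\<close>.
\<close>
lemma pos_part_pos_part_diff:
  assumes z: "z \<in> cone"
  shows "pos_part (pos_part u - z) = pos_part (u - z)"
proof
  fix d
  show "pos_part (pos_part u - z) d = pos_part (u - z) d"
  proof (cases "d \<in> \<Delta>")
    case d: True
    show ?thesis
    proof (cases "pos_at u d")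
      case True
      then show ?thesis using d by (intro pos_part_cong) (auto simp: pos_part_of_pos_at)
    next
      case False
      have neg: "\<not> pos_at (- z) d" using z d by (rule cone_not_neg)
      have "pos_at (pos_part u - z) d = pos_at (- z) d"
        using d False by (intro pos_at_cong) (auto simp: pos_part_of_not_pos_at)
      moreover have "\<not> pos_at (u - z) d"
        using z d
      proof (cases rule: cone_cases)
        case 1
        show ?thesis
        proof
          assume "pos_at (u - z) d"
          then have "pos_at ((u - z) + z) d" using 1 d by (intro pos_at_add)
          then show False using False by simp
        qed
      next
        case 2
        then have "pos_at (u - z) d = pos_at u d" using d by (intro pos_at_cong) auto
        then show ?thesis using False by simp
      qed
      ultimately show ?thesis using neg by (simp add: pos_part_def)
    qed
  qed (simp add: pos_part_outside)
qed

text \<open>\<open>tdiff y (tdiff y x)\<close> is the lexicographic minimum of \<open>x\<close> and \<open>y\<close> on each chain above a point.\<close>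
lemma tdiff_tdiff:
  assumes "x \<in> cone" "y \<in> cone" "d \<in> \<Delta>" "h \<in> up d"
  shows "tdiff y (tdiff y x) h = (if pos_at (y - x) d then x h else y h)"
proof -
  have h: "h \<in> \<Delta>" using assms(4) by (simp add: up_def)
  have up: "k \<in> up d" if "k \<in> up h" for k using up_mono assms(3,4) that by blast
  show ?thesis
  proof (cases "pos_at (y - x) d")
    case True
    then have "pos_part (y - pos_part (y - x)) h = pos_part x h"
      using up assms(3) by (intro pos_part_cong h) (auto simp: pos_part_of_pos_at)
    then show ?thesis using True by (simp add: tdiff_def pos_part_cone assms(1))
  next
    case False
    then have "pos_part (y - pos_part (y - x)) h = pos_part y h"
      using up assms(3) by (intro pos_part_cong h) (auto simp: pos_part_of_not_pos_at)
    then show ?thesis using False by (simp add: tdiff_def pos_part_cone assms(2))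
  qed
qed

lemma tdiff_tdiff_commute:
  assumes "x \<in> cone" "y \<in> cone"
  shows "tdiff x (tdiff x y) = tdiff y (tdiff y x)"
proof
  fix d
  show "tdiff x (tdiff x y) d = tdiff y (tdiff y x) d"
  proof (cases "d \<in> \<Delta>")
    case True
    have "pos_at (x - y) d \<Longrightarrow> \<not> pos_at (y - x) d"
      using pos_at_exclusive[OF True, of "x - y"] by simp
    moreover have "pos_at (x - y) d \<or> pos_at (y - x) d \<or> x d = y d"
      using pos_at_trichotomy[OF True, of "x - y"] up_self[OF True] by auto
    ultimately show ?thesis
      using tdiff_tdiff[OF assms True up_self[OF True]]
        tdiff_tdiff[OF assms(2,1) True up_self[OF True]] by auto
  qed (simp add: tdiff_def pos_part_outside)
qed

sublocale bck: commutative_bck_algebra cone tdiff 0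
proof
  fix x y z :: "'i \<Rightarrow> int"
  assume x: "x \<in> cone" and y: "y \<in> cone" and z: "z \<in> cone"
  have "x - y - z = x - z - y" by (simp add: algebra_simps)
  then show "tdiff (tdiff x y) z = tdiff (tdiff x z) y"
    unfolding tdiff_def pos_part_pos_part_diff[OF z] pos_part_pos_part_diff[OF y]
    by (rule arg_cong)
next
  fix x :: "'i \<Rightarrow> int" assume "x \<in> cone"
  then show "tdiff x x = 0" "tdiff x 0 = x"
    using pos_part_cone[OF zero_in_cone] by (simp_all add: tdiff_def pos_part_cone)
qed (auto intro: tdiff_in_cone zero_in_cone tdiff_tdiff_commute)

section \<open>Ideals are down-sets\<close>

definition supp_ideal :: "'i set \<Rightarrow> ('i \<Rightarrow> int) set" where
  "supp_ideal W = {f \<in> cone. \<forall>d. f d \<noteq> 0 \<longrightarrow> d \<in> W}"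

definition supp_down :: "('i \<Rightarrow> int) \<Rightarrow> 'i set" where
  "supp_down f = {d \<in> \<Delta>. \<exists>e\<in>up d. f e \<noteq> 0}"

definition ind :: "'i set \<Rightarrow> 'i \<Rightarrow> int" where
  "ind W d = (if d \<in> W then 1 else 0)"

lemma down_set_disjoint_up: "down_set W \<Longrightarrow> d \<in> \<Delta> \<Longrightarrow> d \<notin> W \<Longrightarrow> h \<in> up d \<Longrightarrow> h \<notin> W"
  by (auto simp: down_set_def up_def)

lemma down_set_supp_down: "down_set (supp_down f)"
  unfolding down_set_def supp_down_def using up_mono by (fastforce simp: up_def)

lemma down_set_Union: "(\<And>W. W \<in> F \<Longrightarrow> down_set W) \<Longrightarrow> down_set (\<Union>F)"
  unfolding down_set_def by blast

lemma ind_in_cone: "W \<subseteq> \<Delta> \<Longrightarrow> ind W \<in> cone"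
  unfolding cone_def pos_at_def ind_def by (auto intro!: exI[of _ 1])

lemma ind_in_supp_ideal: "down_set W \<Longrightarrow> ind W \<in> supp_ideal W"
  by (auto simp: supp_ideal_def ind_in_cone down_set_def) (auto simp: ind_def split: if_splits)

lemma ideal_supp_ideal:
  assumes W: "down_set W"
  shows "bck.ideal (supp_ideal W)"
  unfolding bck.ideal_def
proof (intro conjI ballI impI)
  show "supp_ideal W \<subseteq> cone" "0 \<in> supp_ideal W"
    by (auto simp: supp_ideal_def zero_in_cone)
  fix x y assume x: "x \<in> cone" and y: "y \<in> cone"
    and xy: "tdiff x y \<in> supp_ideal W \<and> y \<in> supp_ideal W"
  have "x d = 0" if d: "d \<notin> W" for d
  proof (cases "d \<in> \<Delta>")
    case True
    have "y h = 0" if "h \<in> up d" for h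
      using xy down_set_disjoint_up[OF W True d that] by (auto simp: supp_ideal_def)
    then have "tdiff x y d = pos_part x d"
      unfolding tdiff_def using True by (intro pos_part_cong) auto
    then show ?thesis using xy d x by (auto simp: supp_ideal_def pos_part_cone)
  qed (simp add: cone_outside[OF x])
  then show "x \<in> supp_ideal W" using x by (auto simp: supp_ideal_def)
qed

lemma multiple_in_cone:
  assumes "f \<in> cone"
  shows "(\<lambda>d. int n * f d) \<in> cone"
proof -
  obtain N where N: "\<And>d. \<bar>f d\<bar> \<le> N" using assms by (auto simp: cone_def)
  have "\<bar>int n * f d\<bar> \<le> int n * N" for d
    using N[of d] by (simp add: abs_mult mult_left_mono)
  moreover have "\<not> pos_at (- (\<lambda>d. int n * f d)) d" if d: "d \<in> \<Delta>" for d
  proof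
    assume "pos_at (- (\<lambda>d. int n * f d)) d"
    then have "pos_at (- f) d"
      by (auto simp: pos_at_def mult_less_0_iff)
    then show False using cone_not_neg[OF assms d] by simp
  qed
  ultimately show ?thesis using assms unfolding cone_def by auto
qed

lemma multiple_in_ideal:
  assumes J: "bck.ideal J" and f: "f \<in> J"
  shows "(\<lambda>d. int n * f d) \<in> J"
proof (induction n)
  case 0
  have "(\<lambda>d. int 0 * f d) = 0" by auto
  then show ?case using J by (simp add: bck.ideal_def)
next
  case (Suc n)
  have fc: "f \<in> cone" using J f by (auto simp: bck.ideal_def)
  have "(\<lambda>d. int (Suc n) * f d) - f = (\<lambda>d. int n * f d)"
    by (auto simp: algebra_simps)
  then have "tdiff (\<lambda>d. int (Suc n) * f d) f = (\<lambda>d. int n * f d)"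
    unfolding tdiff_def using pos_part_cone[OF multiple_in_cone[OF fc]] by simp
  then show ?case
    using J f Suc multiple_in_cone[OF fc, of "Suc n"] fc unfolding bck.ideal_def by metis
qed

text \<open>
  Membership in an ideal depends only on the down-set generated by the support: a large multiple
  of \<open>f\<close> exceeds \<open>g\<close> at the most significant point of \<open>f\<close> on each chain, and \<open>g\<close> vanishes above
  that point.
\<close>
lemma ideal_absorbs:
  assumes J: "bck.ideal J" and f: "f \<in> J" and g: "g \<in> cone"
    and supp: "\<And>d. g d \<noteq> 0 \<Longrightarrow> d \<in> supp_down f"
  shows "g \<in> J"
proof -
  have fc: "f \<in> cone" using J f by (auto simp: bck.ideal_def)
  obtain N where N: "\<And>d. \<bar>g d\<bar> \<le> N" using g by (auto simp: cone_def)
  define m where "m = (\<lambda>d. int (nat (N + 1)) * f d)"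
  have "N \<ge> 0" using N[of undefined] by linarith
  then have m: "m d = (N + 1) * f d" for d by (simp add: m_def)
  have "\<not> pos_at (g - m) d" if d: "d \<in> \<Delta>" for d
    using fc d
  proof (cases rule: cone_cases)
    case 1
    then obtain e where e: "e \<in> up d" "f e > 0" "\<forall>h\<in>up e. h \<noteq> e \<longrightarrow> f h = 0"
      by (auto simp: pos_at_def)
    have eD: "e \<in> \<Delta>" using e(1) by (simp add: up_def)
    have "pos_at (m - g) d"
    proof (rule pos_atI[OF e(1)])
      have "m e \<ge> (N + 1) * 1"
        unfolding m using e(2) \<open>N \<ge> 0\<close> by (intro mult_left_mono) auto
      then show "(m - g) e > 0" using N[of e] by simp
    next
      fix h assume h: "h \<in> up e" "h \<noteq> e"
      have "k \<in> up e \<and> k \<noteq> e" if "k \<in> up h" for k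
        using that h eD up_mono[OF eD h(1)] antisym[of h e] by (auto simp: up_def)
      then have "h \<notin> supp_down f" using e(3) by (auto simp: supp_down_def)
      then have "g h = 0" using supp by blast
      then show "(m - g) h = 0" using e(3) h m by simp
    qed
    then show ?thesis using pos_at_exclusive[OF d, of "m - g"] by simp
  next
    case 2
    have "(g - m) h = 0" if h: "h \<in> up d" for h
    proof -
      have "h \<notin> supp_down f"
        using 2 up_mono[OF d h] by (auto simp: supp_down_def)
      then have "g h = 0" using supp by blast
      then show ?thesis using 2[OF h] m by simp
    qed
    then show ?thesis by (rule not_pos_at_zero)
  qed
  then have "tdiff g m = 0" unfolding tdiff_def pos_part_def by force
  moreover have "m \<in> J" unfolding m_def by (rule multiple_in_ideal[OF J f])
  ultimately show ?thesis using J g unfolding bck.ideal_def by (metis subset_iff)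
qed

lemma supp_ideal_subset_iff:
  assumes J: "bck.ideal J" and W: "down_set W"
  shows "supp_ideal W \<subseteq> J \<longleftrightarrow> ind W \<in> J"
proof
  assume *: "ind W \<in> J"
  have "W \<subseteq> supp_down (ind W)"
    using W up_self by (force simp: down_set_def supp_down_def ind_def)
  then show "supp_ideal W \<subseteq> J"
    using ideal_absorbs[OF J *] by (auto simp: supp_ideal_def)
qed (use ind_in_supp_ideal[OF W] in auto)

lemma ind_supp_down_in_ideal:
  assumes "bck.ideal J" "f \<in> J"
  shows "ind (supp_down f) \<in> J"
  using assms by (rule ideal_absorbs)
    (auto simp: ind_def supp_down_def split: if_splits intro!: ind_in_cone)

text \<open>Truncated subtraction of \<open>ind W\<close> from \<open>ind (W \<union> V)\<close> leaves a function supported on \<open>V\<close>.\<close>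
lemma ind_Un_in_ideal:
  assumes J: "bck.ideal J" and W: "down_set W" and V: "down_set V"
    and iW: "ind W \<in> J" and iV: "ind V \<in> J"
  shows "ind (W \<union> V) \<in> J"
proof -
  have WV: "W \<subseteq> \<Delta>" "V \<subseteq> \<Delta>" using W V by (auto simp: down_set_def)
  have "ind (W \<union> V) - ind W = ind (V - W)" by (auto simp: ind_def)
  then have "tdiff (ind (W \<union> V)) (ind W) = ind (V - W)"
    unfolding tdiff_def using WV by (metis Diff_subset ind_in_cone order_trans pos_part_cone)
  moreover have "ind (V - W) \<in> supp_ideal V"
    using WV by (auto simp: supp_ideal_def ind_def split: if_splits intro!: ind_in_cone)
  then have "ind (V - W) \<in> J"
    using supp_ideal_subset_iff[OF J V] iV by auto
  ultimately show ?thesis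
    using J iW WV ind_in_cone unfolding bck.ideal_def by (metis Un_least)
qed

lemma ind_Union_in_ideal:
  assumes "finite F" and J: "bck.ideal J" and "\<And>W. W \<in> F \<Longrightarrow> down_set W \<and> ind W \<in> J"
  shows "ind (\<Union>F) \<in> J"
  using assms(1,3)
proof (induction F)
  case empty
  have "ind {} = 0" by (auto simp: ind_def)
  moreover have "0 \<in> J" using J by (simp add: bck.ideal_def)
  ultimately show ?case by (metis Union_empty)
next
  case (insert W F)
  then show ?case using ind_Un_in_ideal[OF J, of W "\<Union>F"] down_set_Union[of F] by simp
qed

text \<open>
  The supports of the members of \<open>J\<close> generate down-sets; by noetherianity finitely many of
  them already cover the union, whose indicator thus lies in \<open>J\<close>.
\<close>
lemma ideal_is_supp_ideal:
  assumes J: "bck.ideal J"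
  shows "\<exists>W. down_set W \<and> J = supp_ideal W"
proof (intro exI conjI)
  define W where "W = \<Union>(supp_down ` J)"
  show W: "down_set W"
    unfolding W_def by (rule down_set_Union) (auto intro: down_set_supp_down)
  have "\<exists>G \<subseteq> supp_down ` J. finite G \<and> \<Union>G = W"
    unfolding W_def using down_set_supp_down by (intro noetherian) (auto simp: down_set_def)
  then obtain G where G: "G \<subseteq> supp_down ` J" "finite G" "\<Union>G = W" by auto
  have "ind (\<Union>G) \<in> J"
    using G(1) down_set_supp_down ind_supp_down_in_ideal[OF J]
    by (intro ind_Union_in_ideal G(2) J) auto
  then have "supp_ideal W \<subseteq> J" using supp_ideal_subset_iff[OF J W] G(3) by simp
  moreover have "f \<in> supp_ideal W" if f: "f \<in> J" for f
  proof -
    have fc: "f \<in> cone" using J f by (auto simp: bck.ideal_def)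
    have "d \<in> supp_down f" if "f d \<noteq> 0" for d
      using that cone_outside[OF fc] up_self by (auto simp: supp_down_def)
    then show ?thesis using f fc by (auto simp: supp_ideal_def W_def)
  qed
  ultimately show "J = supp_ideal W" by auto
qed

section \<open>Open sets of the spectrum\<close>

lemma in_sigma_iff:
  "down_set W \<Longrightarrow> P \<in> bck.sigma (supp_ideal W) \<longleftrightarrow> bck.prime_ideal P \<and> ind W \<notin> P"
  using supp_ideal_subset_iff by (auto simp: bck.sigma_def bck.prime_ideal_def)

text \<open>
  On the chain above \<open>d\<close> the meet of \<open>x\<close> and \<open>y\<close> coincides with \<open>x\<close> or with \<open>y\<close>, which makes the
  ideal of functions vanishing there prime.
\<close>
lemma prime_ideal_vanishing_above:
  assumes d: "d \<in> \<Delta>"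
  shows "bck.prime_ideal (supp_ideal (\<Delta> - up d))"
proof -
  have in_iff: "f \<in> supp_ideal (\<Delta> - up d) \<longleftrightarrow> (\<forall>h\<in>up d. f h = 0)" if "f \<in> cone" for f
    using that cone_outside[OF that] by (auto simp: supp_ideal_def)
  have "down_set (\<Delta> - up d)"
    unfolding down_set_def up_def using trans[OF d] by blast
  then have "bck.ideal (supp_ideal (\<Delta> - up d))" by (rule ideal_supp_ideal)
  moreover have "ind \<Delta> \<notin> supp_ideal (\<Delta> - up d)"
    using d up_self[OF d] by (auto simp: supp_ideal_def ind_def)
  then have "supp_ideal (\<Delta> - up d) \<noteq> cone" using ind_in_cone by blast
  moreover have "x \<in> supp_ideal (\<Delta> - up d) \<or> y \<in> supp_ideal (\<Delta> - up d)"
    if xy: "x \<in> cone" "y \<in> cone" and "bck.meet x y \<in> supp_ideal (\<Delta> - up d)" for x y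
  proof -
    have "bck.meet x y \<in> cone" unfolding bck.meet_def using xy by (intro tdiff_in_cone)
    then have "\<forall>h\<in>up d. bck.meet x y h = 0" using that(3) in_iff by blast
    then have "\<forall>h\<in>up d. (if pos_at (y - x) d then x h else y h) = 0"
      using tdiff_tdiff[OF xy d] unfolding bck.meet_def by (metis (no_types))
    then have "(\<forall>h\<in>up d. x h = 0) \<or> (\<forall>h\<in>up d. y h = 0)"
      by (cases "pos_at (y - x) d") simp_all
    then show ?thesis using in_iff xy by blast
  qed
  ultimately show ?thesis unfolding bck.prime_ideal_def by blast
qed

lemma sigma_supp_ideal_mono:
  "W \<subseteq> V \<Longrightarrow> bck.sigma (supp_ideal W) \<subseteq> bck.sigma (supp_ideal V)"
  unfolding bck.sigma_def supp_ideal_def by blast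

lemma sigma_supp_ideal_Union:
  assumes "finite F" "\<And>W. W \<in> F \<Longrightarrow> down_set W"
  shows "bck.sigma (supp_ideal (\<Union>F)) = (\<Union>W\<in>F. bck.sigma (supp_ideal W))"
proof
  show "bck.sigma (supp_ideal (\<Union>F)) \<subseteq> (\<Union>W\<in>F. bck.sigma (supp_ideal W))"
  proof
    fix P assume "P \<in> bck.sigma (supp_ideal (\<Union>F))"
    then have P: "bck.prime_ideal P" "ind (\<Union>F) \<notin> P"
      using in_sigma_iff[OF down_set_Union[of F]] assms by auto
    then obtain W where "W \<in> F" "ind W \<notin> P"
      using ind_Union_in_ideal[OF assms(1)] assms(2) bck.prime_ideal_def by blast
    then show "P \<in> (\<Union>W\<in>F. bck.sigma (supp_ideal W))"
      using in_sigma_iff P assms(2) by auto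
  qed
  show "(\<Union>W\<in>F. bck.sigma (supp_ideal W)) \<subseteq> bck.sigma (supp_ideal (\<Union>F))"
    using sigma_supp_ideal_mono by blast
qed

lemma sigma_supp_ideal_Int:
  assumes W: "down_set W" and V: "down_set V"
  shows "bck.sigma (supp_ideal (W \<inter> V)) = bck.sigma (supp_ideal W) \<inter> bck.sigma (supp_ideal V)"
proof
  show "bck.sigma (supp_ideal W) \<inter> bck.sigma (supp_ideal V) \<subseteq> bck.sigma (supp_ideal (W \<inter> V))"
  proof
    fix P assume "P \<in> bck.sigma (supp_ideal W) \<inter> bck.sigma (supp_ideal V)"
    then have P: "bck.prime_ideal P" "ind W \<notin> P" "ind V \<notin> P"
      using in_sigma_iff W V by auto
    have c: "ind W \<in> cone" "ind V \<in> cone"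
      using W V by (auto simp: down_set_def intro!: ind_in_cone)
    have "bck.meet (ind W) (ind V) \<notin> P" using P c by (auto simp: bck.prime_ideal_def)
    moreover have "bck.meet (ind W) (ind V) \<in> supp_ideal W \<inter> supp_ideal V"
      using bck.meet_in_ideal[OF ideal_supp_ideal c] ind_in_supp_ideal W V by auto
    then have "bck.meet (ind W) (ind V) \<in> supp_ideal (W \<inter> V)"
      by (auto simp: supp_ideal_def)
    ultimately show "P \<in> bck.sigma (supp_ideal (W \<inter> V))"
      using P by (auto simp: bck.sigma_def)
  qed
qed (use sigma_supp_ideal_mono in blast)

text \<open>A point \<open>d\<close> of \<open>W\<close> outside \<open>V\<close> yields the prime ideal of functions vanishing above \<open>d\<close>.\<close>
lemma sigma_supp_ideal_subsetD:
  assumes W: "down_set W" and V: "down_set V"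
    and sub: "bck.sigma (supp_ideal W) \<subseteq> bck.sigma (supp_ideal V)"
  shows "W \<subseteq> V"
proof (rule subsetI, rule ccontr)
  fix d assume d: "d \<in> W" "d \<notin> V"
  let ?P = "supp_ideal (\<Delta> - up d)"
  have D: "d \<in> \<Delta>" "W \<subseteq> \<Delta>" "V \<subseteq> \<Delta>" using W V d by (auto simp: down_set_def)
  have "ind W \<notin> ?P" using d up_self[OF D(1)] by (auto simp: supp_ideal_def ind_def)
  moreover have "ind V \<in> ?P"
    using down_set_disjoint_up[OF V D(1) d(2)] D ind_in_cone[OF D(3)]
    by (auto simp: supp_ideal_def ind_def split: if_splits)
  ultimately show False
    using sub in_sigma_iff W V prime_ideal_vanishing_above[OF D(1)] by blast
qed

lemma openin_spectrum_iff:
  "openin bck.spectrum U \<longleftrightarrow> (\<exists>W. down_set W \<and> U = bck.sigma (supp_ideal W))"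
  unfolding bck.openin_spectrum using ideal_is_supp_ideal ideal_supp_ideal by metis

text \<open>By noetherianity every subset of the spectrum is compact.\<close>
lemma compact_opens_eq:
  "bck.compact_opens = (\<lambda>W. bck.sigma (supp_ideal W)) ` {W. down_set W}"
proof -
  have compact: "compactin bck.spectrum S" if S: "S \<subseteq> topspace bck.spectrum" for S
    unfolding compactin_def
  proof (intro conjI allI impI S)
    fix \<U> assume U: "(\<forall>U\<in>\<U>. openin bck.spectrum U) \<and> S \<subseteq> \<Union>\<U>"
    define F where "F = {W. down_set W \<and> bck.sigma (supp_ideal W) \<in> \<U>}"
    have "\<exists>G\<subseteq>F. finite G \<and> \<Union>G = \<Union>F"
      by (intro noetherian) (auto simp: F_def down_set_def)
    then obtain G where G: "G \<subseteq> F" "finite G" "\<Union>G = \<Union>F" by (elim exE conjE)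
    have "U \<subseteq> bck.sigma (supp_ideal (\<Union>G))" if "U \<in> \<U>" for U
    proof -
      have "openin bck.spectrum U" using U that by blast
      then obtain W where W: "down_set W" "U = bck.sigma (supp_ideal W)"
        unfolding openin_spectrum_iff by (elim exE conjE)
      then have "W \<in> F" using that by (simp add: F_def)
      then have "W \<subseteq> \<Union>G" unfolding G(3) by blast
      then show ?thesis using W(2) sigma_supp_ideal_mono by simp
    qed
    then have "S \<subseteq> bck.sigma (supp_ideal (\<Union>G))" using U by blast
    also have "\<dots> = \<Union>((\<lambda>W. bck.sigma (supp_ideal W)) ` G)"
      using G(1) by (intro sigma_supp_ideal_Union G(2)) (auto simp: F_def)
    finally have "S \<subseteq> \<Union>((\<lambda>W. bck.sigma (supp_ideal W)) ` G)" .
    moreover have "(\<lambda>W. bck.sigma (supp_ideal W)) ` G \<subseteq> \<U>" using G(1) by (auto simp: F_def)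
    ultimately show "\<exists>\<F>. finite \<F> \<and> \<F> \<subseteq> \<U> \<and> S \<subseteq> \<Union>\<F>"
      using G(2) by (metis finite_imageI)
  qed
  have "U \<in> bck.compact_opens \<longleftrightarrow> openin bck.spectrum U" for U
    unfolding bck.compact_opens_def mem_Collect_eq using compact[OF openin_subset[of _ U]] by blast
  then show ?thesis unfolding openin_spectrum_iff by (simp add: set_eq_iff image_iff conj_commute)
qed

lemma sigma_bij_down_sets:
  "bij_betw (\<lambda>W. bck.sigma (supp_ideal W)) {W. down_set W} bck.compact_opens"
  unfolding bij_betw_def compact_opens_eq
  using sigma_supp_ideal_subsetD by (auto intro!: inj_onI)

end

lemma in_image_KX_if_down_sets:
  fixes \<Delta> :: "nat set" and \<psi> :: "'d::lattice \<Rightarrow> nat set"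
  assumes "noetherian_root_system \<Delta> le"
    and bij: "bij_betw \<psi> UNIV {W. noetherian_root_system.down_set \<Delta> le W}"
    and inf: "\<And>x y. \<psi> (inf x y) = \<psi> x \<inter> \<psi> y"
    and sup: "\<And>x y. \<psi> (sup x y) = \<psi> x \<union> \<psi> y"
  shows "in_image_KX TYPE('d)"
proof -
  interpret noetherian_root_system \<Delta> le by fact
  define \<phi> where "\<phi> = (\<lambda>x. bck.sigma (supp_ideal (\<psi> x)))"
  have down: "down_set (\<psi> x)" for x using bij by (auto simp: bij_betw_def)
  have "bij_betw \<phi> UNIV bck.compact_opens"
    using bij_betw_trans[OF bij sigma_bij_down_sets] by (simp add: \<phi>_def comp_def)
  moreover have "\<phi> (Lattices.inf x y) = \<phi> x \<inter> \<phi> y" for x y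
    by (simp add: \<phi>_def inf sigma_supp_ideal_Int down)
  moreover have "\<phi> (Lattices.sup x y) = \<phi> x \<union> \<phi> y" for x y
    using sigma_supp_ideal_Union[of "{\<psi> x, \<psi> y}"] down by (force simp: \<phi>_def sup)
  ultimately show ?thesis
    unfolding in_image_KX_def using bck.commutative_bck_algebra_axioms by blast
qed

section \<open>Finite lattices with a root system of meet-irreducibles\<close>

lemma MI_D: "m \<in> MI \<Longrightarrow> m = inf a b \<Longrightarrow> m = a \<or> m = b"
  unfolding MI_def by blast

text \<open>
  A maximal element of \<open>{x. e \<le> x \<and> \<not> d \<le> x}\<close> is meet-irreducible: strictly larger elements lie
  above \<open>d\<close>, and so do their meets.
\<close>
lemma MI_separates:
  fixes d e :: "'a::{finite,lattice}"
  assumes "\<not> d \<le> e"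
  shows "\<exists>m\<in>MI. e \<le> m \<and> \<not> d \<le> m"
proof -
  obtain m where m: "e \<le> m" "\<not> d \<le> m" and max: "\<And>x. m \<le> x \<Longrightarrow> e \<le> x \<Longrightarrow> \<not> d \<le> x \<Longrightarrow> x = m"
    using finite_has_maximal[of "{x. e \<le> x \<and> \<not> d \<le> x}"] assms
    by (metis (mono_tags, lifting) empty_iff finite mem_Collect_eq order_refl)
  have "m = a \<or> m = b" if "m = inf a b" for a b
  proof (rule ccontr)
    assume "\<not> (m = a \<or> m = b)"
    moreover have "m \<le> a" "m \<le> b" using that by auto
    ultimately have "d \<le> a" "d \<le> b" using max m(1) order_trans by metis+
    then show False using that m(2) by simp
  qed
  then have "m \<in> MI" unfolding MI_def using m by auto
  then show ?thesis using m by auto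
qed

text \<open>The witness is the meet of \<open>S\<close>, which is the top element if \<open>S\<close> is empty.\<close>
lemma exists_above_iff_above_some:
  fixes S :: "'a::{finite,lattice} set"
  assumes prime: "\<And>m a b :: 'a. m \<in> MI \<Longrightarrow> inf a b \<le> m \<Longrightarrow> a \<le> m \<or> b \<le> m"
  shows "\<exists>d::'a. \<forall>m\<in>MI. d \<le> m \<longleftrightarrow> (\<exists>s\<in>S. s \<le> m)"
proof (induction S rule: finite_induct[OF finite])
  case 1
  have "x \<le> Sup_fin UNIV" for x :: 'a by (rule Sup_fin.coboundedI) auto
  then have "\<forall>m\<in>MI. \<not> Sup_fin UNIV \<le> (m::'a)" unfolding MI_def using order_trans by blast
  then show ?case by auto
next
  case (2 s S)
  then obtain d :: 'a where d: "\<forall>m\<in>MI. d \<le> m \<longleftrightarrow> (\<exists>s\<in>S. s \<le> m)" by auto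
  have "inf s d \<le> m \<longleftrightarrow> s \<le> m \<or> d \<le> m" if "m \<in> MI" for m
    using prime[OF that, of s d] by (auto intro: le_infI1 le_infI2)
  then show ?case using d by (intro exI[of _ "inf s d"]) simp
qed

text \<open>
  Birkhoff duality: \<open>d\<close> corresponds to the set of meet-irreducibles that are not above it.
  The enumeration \<open>c\<close> only moves this poset into the natural numbers. Distributivity enters as
  primality of the meet-irreducibles, so that the lemma also covers chains in the class of
  lattices.
\<close>
lemma in_image_KX_if_MI_root_system:
  assumes prime: "\<And>m a b :: 'a::{finite,lattice}. m \<in> MI \<Longrightarrow> inf a b \<le> m \<Longrightarrow> a \<le> m \<or> b \<le> m"
    and chain: "\<And>m p q :: 'a. \<lbrakk>m \<in> MI; p \<in> MI; q \<in> MI; m \<le> p; m \<le> q\<rbrakk> \<Longrightarrow> p \<le> q \<or> q \<le> p"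
  shows "in_image_KX TYPE('a)"
proof -
  obtain c :: "'a \<Rightarrow> nat" where c: "inj c"
    using finite_imp_inj_to_nat_seg[of "UNIV :: 'a set"] by auto
  define \<Delta> where "\<Delta> = c ` (MI :: 'a set)"
  define le where "le i j \<longleftrightarrow> inv c i \<le> inv c j" for i j
  define \<psi> where "\<psi> d = c ` {m \<in> MI. \<not> d \<le> m}" for d
  have le_c: "le (c p) (c q) \<longleftrightarrow> p \<le> q" for p q by (simp add: le_def c)
  have root: "noetherian_root_system \<Delta> le"
  proof
    fix F :: "nat set set"
    assume *: "\<And>W. W \<in> F \<Longrightarrow> W \<subseteq> \<Delta> \<and> (\<forall>d\<in>W. \<forall>c\<in>\<Delta>. le c d \<longrightarrow> c \<in> W)"
    then have "F \<subseteq> Pow \<Delta>" by auto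
    then have "finite F" by (rule finite_subset) (simp add: \<Delta>_def)
    then show "\<exists>G\<subseteq>F. finite G \<and> \<Union>G = \<Union>F" by blast
  next
    fix i j k assume "i \<in> \<Delta>" "j \<in> \<Delta>" "k \<in> \<Delta>" and le: "le i j" "le i k"
    then obtain m p q where "m \<in> MI" "p \<in> MI" "q \<in> MI" "i = c m" "j = c p" "k = c q"
      unfolding \<Delta>_def by blast
    then show "le j k \<or> le k j" using chain[of m p q] le by (simp add: le_c)
  qed (auto simp: \<Delta>_def le_c)
  interpret noetherian_root_system \<Delta> le by (rule root)
  have "inj \<psi>"
  proof (rule injI)
    fix d e assume "\<psi> d = \<psi> e"
    then have "{m \<in> MI. \<not> d \<le> m} = {m \<in> MI. \<not> e \<le> m}"
      using c by (simp add: \<psi>_def inj_image_eq_iff)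
    then have iff: "m \<in> MI \<Longrightarrow> d \<le> m \<longleftrightarrow> e \<le> m" for m by blast
    then have "d \<le> e" "e \<le> d" using MI_separates by blast+
    then show "d = e" by simp
  qed
  moreover have "range \<psi> = {W. down_set W}"
  proof (intro equalityI subsetI)
    fix W assume "W \<in> range \<psi>"
    then show "W \<in> {W. down_set W}"
      unfolding mem_Collect_eq down_set_def
      by (auto simp: \<psi>_def \<Delta>_def le_c intro: order_trans)
  next
    fix W assume "W \<in> {W. down_set W}"
    then have W: "W \<subseteq> \<Delta>" "\<And>i j. i \<in> W \<Longrightarrow> j \<in> \<Delta> \<Longrightarrow> le j i \<Longrightarrow> j \<in> W"
      by (auto simp: down_set_def)
    obtain d :: 'a where d: "\<forall>m\<in>MI. d \<le> m \<longleftrightarrow> (\<exists>s\<in>{s\<in>MI. c s \<notin> W}. s \<le> m)"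
      using exists_above_iff_above_some[OF prime] by blast
    have "d \<le> m \<longleftrightarrow> c m \<notin> W" if m: "m \<in> MI" for m
    proof -
      have "c s \<in> W" if "s \<in> MI" "s \<le> m" "c m \<in> W" for s
        using W(2)[of "c m" "c s"] that by (simp add: \<Delta>_def le_c)
      then show ?thesis using d m by blast
    qed
    then have "\<psi> d = W" using W(1) by (auto simp: \<psi>_def \<Delta>_def)
    then show "W \<in> range \<psi>" by auto
  qed
  ultimately have "bij_betw \<psi> UNIV {W. down_set W}" by (simp add: bij_betw_def)
  moreover have "\<psi> (inf x y) = \<psi> x \<inter> \<psi> y" for x y
  proof -
    have "{m \<in> MI. \<not> inf x y \<le> m} = {m \<in> MI. \<not> x \<le> m} \<inter> {m \<in> MI. \<not> y \<le> m}"
      using prime[of _ x y] by (auto intro: le_infI1 le_infI2)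
    then show ?thesis by (simp add: \<psi>_def image_Int c)
  qed
  moreover have "\<psi> (sup x y) = \<psi> x \<union> \<psi> y" for x y by (auto simp: \<psi>_def)
  ultimately show ?thesis by (rule in_image_KX_if_down_sets[OF root])
qed

lemma MI_prime:
  fixes m a b :: "'a::distrib_lattice"
  assumes "m \<in> MI" "inf a b \<le> m"
  shows "a \<le> m \<or> b \<le> m"
proof -
  have "m = inf (sup m a) (sup m b)"
    using assms(2) by (simp add: sup_inf_distrib1[symmetric] sup_absorb1)
  then have "m = sup m a \<or> m = sup m b" using MI_D[OF assms(1)] by blast
  then show ?thesis by (metis sup_ge2)
qed

section \<open>The five classes of lattices\<close>

lemma tree_ancestors_comparable:
  assumes "rooted_tree V E r" "tree_le E a v" "tree_le E b v"
  shows "tree_le E a b \<or> tree_le E b a"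
proof -
  have "single_valued (E\<inverse>)"
    using assms(1) unfolding rooted_tree_def single_valued_def
    by (metis (no_types, lifting) DiffI SigmaE2 converse_iff singletonD subset_iff)
  then have "(a, b) \<in> (E\<inverse>)\<^sup>* \<or> (b, a) \<in> (E\<inverse>)\<^sup>*"
    using assms(2,3) unfolding tree_le_def
    by (intro single_valued_confluent[of _ v]) (auto simp: rtrancl_converse)
  then show ?thesis by (auto simp: tree_le_def rtrancl_converse)
qed

lemma in_image_KX_tree:
  assumes tree: "rooted_tree V E r"
    and iso: "poset_iso (MI :: 'a::{finite,distrib_lattice} set) (\<le>) V (\<lambda>\<alpha> \<beta>. tree_le E \<beta> \<alpha>)"
  shows "in_image_KX TYPE('a)"
proof (rule in_image_KX_if_MI_root_system)
  obtain f where f: "\<And>x y :: 'a. x \<in> MI \<Longrightarrow> y \<in> MI \<Longrightarrow> x \<le> y \<longleftrightarrow> tree_le E (f y) (f x)"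
    using iso unfolding poset_iso_def by blast
  fix m p q :: 'a assume "m \<in> MI" "p \<in> MI" "q \<in> MI" "m \<le> p" "m \<le> q"
  then show "p \<le> q \<or> q \<le> p"
    using f tree_ancestors_comparable[OF tree, of "f p" "f m" "f q"] by blast
qed (rule MI_prime)

lemma in_image_KX_finite_chain:
  assumes "\<forall>x y :: 'b::{finite,lattice}. x \<le> y \<or> y \<le> x"
  shows "in_image_KX TYPE('b)"
proof (rule in_image_KX_if_MI_root_system)
  fix m a b :: 'b assume "inf a b \<le> m"
  then show "a \<le> m \<or> b \<le> m"
    using assms[rule_format, of a b] by (auto simp: inf_absorb1 inf_absorb2)
qed (use assms in blast)

text \<open>
  The root system is \<open>\<nat>\<close> with the reversed order; its down-sets are the sets \<open>{n. k \<le> n}\<close>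
  with \<open>k\<close> finite or infinite.
\<close>
lemma in_image_KX_enat_dual:
  assumes "poset_iso (UNIV :: 'c::lattice set) (\<le>) (UNIV :: enat set) (\<lambda>m n. n \<le> m)"
  shows "in_image_KX TYPE('c)"
proof -
  obtain f :: "'c \<Rightarrow> enat" where f: "bij f" and le: "\<And>x y. x \<le> y \<longleftrightarrow> f y \<le> f x"
    using assms unfolding poset_iso_def by auto
  define \<psi> where "\<psi> x = {n. f x \<le> enat n}" for x
  have root: "noetherian_root_system (UNIV :: nat set) (\<lambda>i j. j \<le> i)"
  proof
    fix F :: "nat set set"
    assume F: "\<And>W. W \<in> F \<Longrightarrow> W \<subseteq> UNIV \<and> (\<forall>d\<in>W. \<forall>c\<in>UNIV. d \<le> c \<longrightarrow> c \<in> W)"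
    show "\<exists>G\<subseteq>F. finite G \<and> \<Union>G = \<Union>F"
    proof (cases "\<Union>F = {}")
      case False
      then have "(LEAST n. n \<in> \<Union>F) \<in> \<Union>F" by (metis LeastI ex_in_conv)
      then obtain W where W: "W \<in> F" "(LEAST n. n \<in> \<Union>F) \<in> W" by auto
      have "n \<in> W" if "n \<in> \<Union>F" for n
        using F[OF W(1)] W(2) Least_le[of "\<lambda>n. n \<in> \<Union>F", OF that] by blast
      then show ?thesis using W(1) by (intro exI[of _ "{W}"]) auto
    qed auto
  qed auto
  interpret noetherian_root_system "UNIV :: nat set" "\<lambda>i j. j \<le> i" by (rule root)
  have enat_le_if_upper_subset: "a \<le> b" if "{n. b \<le> enat n} \<subseteq> {n. a \<le> enat n}" for a b :: enat
    using that by (cases b) auto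
  have "inj \<psi>"
  proof (rule injI)
    fix x y assume "\<psi> x = \<psi> y"
    then have "f x \<le> f y" "f y \<le> f x"
      unfolding \<psi>_def by (auto intro: enat_le_if_upper_subset)
    then have "f x = f y" by (rule order_antisym)
    then show "x = y" using f by (simp add: bij_def inj_eq)
  qed
  moreover have "range \<psi> = {W. down_set W}"
  proof (intro equalityI subsetI)
    fix W assume "W \<in> range \<psi>"
    then show "W \<in> {W. down_set W}"
      unfolding down_set_def \<psi>_def using order_trans by fastforce
  next
    fix W assume "W \<in> {W. down_set W}"
    then have W: "\<And>m n. m \<in> W \<Longrightarrow> m \<le> n \<Longrightarrow> n \<in> W" by (auto simp: down_set_def)
    have "\<exists>k. W = {n. k \<le> enat n}"
    proof (cases "W = {}")
      case True
      then show ?thesis by (intro exI[of _ \<infinity>]) auto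
    next
      case False
      define k where "k = (LEAST n. n \<in> W)"
      have "k \<in> W" unfolding k_def using False by (metis LeastI ex_in_conv)
      moreover have "k \<le> n" if "n \<in> W" for n unfolding k_def using that by (rule Least_le)
      ultimately have "n \<in> W \<longleftrightarrow> enat k \<le> enat n" for n using W[of k n] by auto
      then have "W = {n. enat k \<le> enat n}" by blast
      then show ?thesis by blast
    qed
    then obtain k where "W = {n. k \<le> enat n}" by blast
    then have "W = \<psi> (inv f k)" using f by (simp add: \<psi>_def bij_is_surj surj_f_inv_f)
    then show "W \<in> range \<psi>" by blast
  qed
  ultimately have "bij_betw \<psi> UNIV {W. down_set W}" by (simp add: bij_betw_def)
  moreover have "\<psi> (inf x y) = \<psi> x \<inter> \<psi> y \<and> \<psi> (sup x y) = \<psi> x \<union> \<psi> y" for x y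
  proof -
    have mono: "u \<le> v \<Longrightarrow> \<psi> u \<subseteq> \<psi> v" for u v
      unfolding le \<psi>_def by (auto intro: order_trans)
    have "x \<le> y \<or> y \<le> x" unfolding le by (rule linear)
    then show ?thesis
      using mono[of x y] mono[of y x] by (auto simp: inf_absorb1 inf_absorb2 sup_absorb1 sup_absorb2)
  qed
  ultimately show ?thesis by (intro in_image_KX_if_down_sets[OF root]) blast+
qed

locale distributive_p_algebra =
  fixes star :: "'d::{distrib_lattice,bounded_lattice} \<Rightarrow> 'd"
  assumes pseudo: "pseudocomplementation star"
begin

lemma le_star_iff: "y \<le> star x \<longleftrightarrow> inf x y = bot"
  using pseudo by (simp add: pseudocomplementation_def)

lemma inf_star: "inf x (star x) = bot"
  using le_star_iff[of "star x" x] by simp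

lemma star_eqI:
  assumes "\<And>z. inf x z = bot \<longleftrightarrow> inf y z = bot"
  shows "star x = star y"
proof (rule order_antisym)
  show "star x \<le> star y" unfolding le_star_iff assms[symmetric] by (rule inf_star)
  show "star y \<le> star x" unfolding le_star_iff assms by (rule inf_star)
qed

lemma star_cancel:
  assumes "star x = star y"
  shows "inf x z = bot \<longleftrightarrow> inf y z = bot"
  unfolding le_star_iff[symmetric] assms by (rule refl)

lemma star_star_star: "star (star (star x)) = star x"
proof (rule order_antisym)
  have "x \<le> star (star x)" by (simp add: le_star_iff inf_commute inf_star)
  then have "inf x (star (star (star x))) \<le> inf (star (star x)) (star (star (star x)))"
    by (intro inf_mono) auto
  then have "inf x (star (star (star x))) = bot" by (simp add: inf_star bot_unique)
  then show "star (star (star x)) \<le> star x" by (simp add: le_star_iff)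
qed (simp add: le_star_iff inf_commute inf_star)

text \<open>Compatibility with \<open>star\<close> holds because \<open>inf (star x) d\<close> is determined by \<open>inf x d\<close>.\<close>
lemma p_congruence_inf: "p_congruence star {(x, y). inf x d = inf y d}"
proof -
  have star: "inf (star x) d = inf (star y) d" if "inf x d = inf y d" for x y
  proof -
    have "inf (star u) d \<le> star v" if "inf u d = inf v d" for u v
    proof -
      have "inf v (inf (star u) d) = inf (inf v d) (star u)" by (simp add: ac_simps)
      also have "\<dots> = inf (inf u d) (star u)" by (simp only: that)
      also have "\<dots> = inf d (inf u (star u))" by (simp add: ac_simps)
      finally show ?thesis by (simp add: le_star_iff inf_star)
    qed
    from this[OF that] this[OF that[symmetric]] show ?thesis by (simp add: order_antisym)
  qed
  have inf_compat: "inf (inf x y) d = inf (inf x' y') d"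
    if "inf x d = inf x' d" "inf y d = inf y' d" for x x' y y'
    using that by (metis inf_assoc inf_commute)
  let ?T = "{(x, y). inf x d = inf y d}"
  have "equiv UNIV ?T" by (auto simp: equiv_def refl_on_def sym_def trans_def)
  moreover have "(star x, star y) \<in> ?T" if "(x, y) \<in> ?T" for x y
    using star[of x y] that by simp
  moreover have "(inf x y, inf x' y') \<in> ?T \<and> (sup x y, sup x' y') \<in> ?T"
    if "(x, x') \<in> ?T" "(y, y') \<in> ?T" for x x' y y'
    using inf_compat[of x x' y y'] that by (simp add: inf_sup_distrib2)
  ultimately show ?thesis unfolding p_congruence_def by blast
qed

text \<open>
  The relation \<open>sup x d = sup y d\<close> alone need not respect \<open>star\<close>; it is intersected with the
  Glivenko congruence \<open>star x = star y\<close>.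
\<close>
lemma p_congruence_sup_star:
  "p_congruence star {(x, y). sup x d = sup y d \<and> star x = star y}"
proof -
  have sup_compat: "sup (sup x y) d = sup (sup x' y') d"
    if "sup x d = sup x' d" "sup y d = sup y' d" for x x' y y'
    using that by (metis sup_assoc sup_commute)
  have star_sup: "star (sup x y) = star (sup x' y')"
    if "star x = star x'" "star y = star y'" for x x' y y'
  proof (rule star_eqI)
    fix z
    show "inf (sup x y) z = bot \<longleftrightarrow> inf (sup x' y') z = bot"
      using star_cancel[OF that(1), of z] star_cancel[OF that(2), of z]
      by (simp add: inf_sup_distrib2 sup_eq_bot_iff)
  qed
  have star_inf: "star (inf x y) = star (inf x' y')"
    if "star x = star x'" "star y = star y'" for x x' y y'
  proof (rule star_eqI)
    fix z
    show "inf (inf x y) z = bot \<longleftrightarrow> inf (inf x' y') z = bot"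
      using star_cancel[OF that(1), of "inf y z"] star_cancel[OF that(2), of "inf x' z"]
      by (simp add: ac_simps)
  qed
  let ?T = "{(x, y). sup x d = sup y d \<and> star x = star y}"
  have "equiv UNIV ?T" by (auto simp: equiv_def refl_on_def sym_def trans_def)
  moreover have "(star x, star y) \<in> ?T" if "(x, y) \<in> ?T" for x y
    using that by simp
  moreover have "(inf x y, inf x' y') \<in> ?T \<and> (sup x y, sup x' y') \<in> ?T"
    if "(x, x') \<in> ?T" "(y, y') \<in> ?T" for x x' y y'
    using sup_compat[of x x' y y'] star_sup[of x x' y y'] star_inf[of x x' y y'] that
    by (simp add: sup_inf_distrib2)
  ultimately show ?thesis unfolding p_congruence_def by blast
qed

lemma subdirectly_irreducible_pair:
  assumes "p_subdirectly_irreducible star" "p_congruence star \<theta>" "p_congruence star \<eta>"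
    and sep: "\<And>x y. (x, y) \<in> \<theta> \<Longrightarrow> (x, y) \<in> \<eta> \<Longrightarrow> x = y"
  shows "\<theta> = Id \<or> \<eta> = Id"
proof -
  have "(x, x) \<in> \<theta>" "(x, x) \<in> \<eta>" for x
    using assms(2,3) by (auto simp: p_congruence_def equiv_def refl_on_def)
  then have "\<Inter>{\<theta>, \<eta>} = Id" using sep by auto
  then have "Id \<in> {\<theta>, \<eta>}"
    using assms(1)[unfolded p_subdirectly_irreducible_def, rule_format, of "{\<theta>, \<eta>}"] assms(2,3)
    by blast
  then show ?thesis by blast
qed

text \<open>
  By distributivity the two congruences attached to \<open>d\<close> meet in the identity. The first
  one relates \<open>d\<close> to the top element, so it is the second one that must be trivial.
\<close>
lemma subdirectly_irreducible_cancel: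
  assumes si: "p_subdirectly_irreducible star" and "d \<noteq> top"
    and "sup x d = sup y d" "star x = star y"
  shows "x = y"
proof -
  let ?I = "{(x, y). inf x d = inf y d}"
  let ?S = "{(x, y). sup x d = sup y d \<and> star x = star y}"
  have "u = v" if "inf u d = inf v d" "sup u d = sup v d" for u v
  proof -
    have "u = inf u (sup v d)" using that(2) by (metis inf_sup_absorb)
    also have "\<dots> = sup (inf v u) (inf v d)" using that(1) by (simp add: inf_sup_distrib1 inf_commute)
    also have "\<dots> = v" using that(2) by (metis inf_sup_absorb inf_sup_distrib1)
    finally show ?thesis .
  qed
  then have "?I = Id \<or> ?S = Id"
    by (intro subdirectly_irreducible_pair[OF si p_congruence_inf p_congruence_sup_star]) simp
  moreover have "?I \<noteq> Id"
  proof
    assume *: "?I = Id"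
    have "(d, top) \<in> ?I" by simp
    then show False unfolding * using assms(2) by simp
  qed
  ultimately have *: "?S = Id" by argo
  have "(x, y) \<in> ?S" using assms(3,4) by simp
  then show ?thesis unfolding * by simp
qed

text \<open>If \<open>sup p q\<close> is the top, an element is determined by its meets with \<open>p\<close> and with \<open>q\<close>.\<close>
lemma subdirectly_irreducible_top_join_irreducible:
  fixes p q :: 'd
  assumes si: "p_subdirectly_irreducible star" and "sup p q = top"
  shows "p = top \<or> q = top"
proof -
  let ?I = "\<lambda>d. {(x, y). inf x d = inf y d}"
  have "x = y" if "inf x p = inf y p" "inf x q = inf y q" for x y
    using that assms(2) by (metis inf_sup_distrib1 inf_top_right)
  then have "?I p = Id \<or> ?I q = Id"
    by (intro subdirectly_irreducible_pair[OF si p_congruence_inf p_congruence_inf]) simp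
  moreover have "d = top" if "?I d = Id" for d :: 'd
  proof -
    have "(d, top) \<in> ?I d" by simp
    then show ?thesis unfolding that by simp
  qed
  ultimately show ?thesis by (elim disjE) simp_all
qed

text \<open>
  A meet-irreducible \<open>m\<close> below a regular element \<open>u\<close> other than the top equals \<open>u\<close>, since
  \<open>m = inf u (sup m (star u))\<close>. In the subdirectly irreducible case all other elements are dense,
  and all dense elements other than the top coincide. So if \<open>p\<close> and \<open>q\<close> differ, one of them is
  regular and equals \<open>m\<close>.
\<close>
lemma subdirectly_irreducible_MI_chain:
  fixes m p q :: 'd
  assumes si: "p_subdirectly_irreducible star"
    and MI: "m \<in> MI" "p \<in> MI" "q \<in> MI" and le: "m \<le> p" "m \<le> q"
  shows "p \<le> q \<or> q \<le> p"
proof -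
  have ne_top: "p \<noteq> top" "q \<noteq> top" using MI by (auto simp: MI_def)
  have star_bot: "star bot = top" using le_star_iff[of top bot] by (simp add: top_unique)
  have regular: "m = u" if "u \<noteq> top" "m \<le> u" "star (star u) = u" for u
  proof -
    have "m = inf u (sup m (star u))"
      using that by (simp add: inf_sup_distrib1 inf_star inf_absorb2)
    then have "m = u \<or> m = sup m (star u)" by (rule MI_D[OF MI(1)])
    moreover have "m \<noteq> sup m (star u)"
    proof
      assume "m = sup m (star u)"
      then have "star u \<le> u" using that(2) by (metis order_trans sup_ge2)
      then have "star u = bot" using inf_star[of u] by (simp add: inf_absorb2)
      then show False using that star_bot by simp
    qed
    ultimately show ?thesis by blast
  qed
  have dense: "star u = bot" if "star (star u) \<noteq> u" for u
  proof -
    have "u \<le> star (star u)" by (simp add: le_star_iff inf_commute inf_star)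
    then have "star (star u) = top"
      using subdirectly_irreducible_cancel[OF si, of "star (star u)" u "star (star u)"] that
      by (auto simp: star_star_star sup_absorb2)
    then show ?thesis using inf_star[of "star u"] by simp
  qed
  show ?thesis
  proof (cases "star (star p) = p \<or> star (star q) = q")
    case True
    then show ?thesis using regular ne_top le by blast
  next
    case False
    then have "star p = star q" using dense by metis
    moreover have "sup p q \<noteq> top"
      using subdirectly_irreducible_top_join_irreducible[OF si] ne_top by blast
    ultimately show ?thesis
      using subdirectly_irreducible_cancel[OF si, of "sup p q" p q] by (simp add: ac_simps)
  qed
qed

end

lemma in_image_KX_p_algebra:
  fixes star :: "'d::{finite,distrib_lattice,bounded_lattice} \<Rightarrow> 'd"
  assumes "pseudocomplementation star" "p_subdirectly_irreducible star"
  shows "in_image_KX TYPE('d)"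
proof -
  interpret distributive_p_algebra star using assms(1) by unfold_locales
  show ?thesis
    by (rule in_image_KX_if_MI_root_system)
      (rule MI_prime, assumption+, rule subdirectly_irreducible_MI_chain[OF assms(2)])
qed

text \<open>
  Irreducibility applied to \<open>m = inf p (sup m (- p))\<close> leaves \<open>m = p\<close> or \<open>- p \<le> m \<le> p\<close>; in the
  second case \<open>p\<close> would be the top element.
\<close>
lemma MI_antichain:
  fixes m p :: "'e::boolean_algebra"
  assumes "m \<in> MI" "p \<in> MI" "m \<le> p"
  shows "m = p"
proof -
  have "m = inf p (sup m (- p))"
    using assms(3) by (simp add: inf_sup_distrib1 inf_absorb2)
  then have "m = p \<or> m = sup m (- p)" by (rule MI_D[OF assms(1)])
  moreover have "m \<noteq> sup m (- p)"
  proof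
    assume "m = sup m (- p)"
    then have "- p \<le> p" using assms(3) by (metis order_trans sup_ge2)
    then have "p = top" by (metis sup.absorb_iff1 sup_compl_top)
    then show False using assms(2) by (auto simp: MI_def)
  qed
  ultimately show ?thesis by blast
qed

lemma in_image_KX_boolean: "in_image_KX TYPE('e::{finite,boolean_algebra})"
proof (rule in_image_KX_if_MI_root_system)
  fix m p q :: 'e assume "m \<in> MI" "p \<in> MI" "q \<in> MI" "m \<le> p" "m \<le> q"
  then have "m = p" "m = q" using MI_antichain by blast+
  then show "p \<le> q \<or> q \<le> p" by simp
qed (rule MI_prime)

theorem theorem5p6:
  shows "(\<forall>(V :: 'v set) E r. finite V \<and> rooted_tree V E r \<and>
            poset_iso (MI :: 'a::{finite,distrib_lattice} set) (\<le>) V (\<lambda>\<alpha> \<beta>. tree_le E \<beta> \<alpha>) \<longrightarrow>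
            in_image_KX TYPE('a)) \<and>
         ((\<forall>x y :: 'b::{finite,lattice}. x \<le> y \<or> y \<le> x) \<longrightarrow> in_image_KX TYPE('b)) \<and>
         (poset_iso (UNIV :: 'c::lattice set) (\<le>) (UNIV :: enat set) (\<lambda>m n. n \<le> m) \<longrightarrow>
            in_image_KX TYPE('c)) \<and>
         (\<forall>star :: 'd::{finite,distrib_lattice,bounded_lattice} \<Rightarrow> 'd.
            pseudocomplementation star \<and> p_subdirectly_irreducible star \<longrightarrow>
            in_image_KX TYPE('d)) \<and>
         in_image_KX TYPE('e::{finite,boolean_algebra})"
proof (intro conjI allI impI)
  fix V :: "'v set" and E r
  assume "finite V \<and> rooted_tree V E r \<and>
    poset_iso (MI :: 'a set) (\<le>) V (\<lambda>\<alpha> \<beta>. tree_le E \<beta> \<alpha>)"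
  then show "in_image_KX TYPE('a)" by (elim conjE) (rule in_image_KX_tree)
next
  fix star :: "'d \<Rightarrow> 'd"
  assume "pseudocomplementation star \<and> p_subdirectly_irreducible star"
  then show "in_image_KX TYPE('d)" by (elim conjE) (rule in_image_KX_p_algebra)
qed (rule in_image_KX_finite_chain in_image_KX_enat_dual in_image_KX_boolean; assumption)+

end
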